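(* Let $G=(V,E)$ be a graph with $n$ vertices. Assume that $|\psi\rangle$ is a state prepared by a $\mathbf Z_2$-symmetric range-$R$ circuit such that for all $e=\{e_0,e_1\}\in E$, $\langle\psi|Z_{e_0}Z_{e_1}|\psi\rangle\in\{0,-1\}$. Denote by $C_l$ the number of cycles of $G$ of length at most $l$. Then $$\langle\psi|\sum_{\{e_0,e_1\}\in E}\frac{1-Z_{e_0}Z_{e_1}}{2}|\psi\rangle\ \le\ \frac12\left(|E|+n+(4R+1)\,C_{4R+1}\right).$$
   Context: Qubits are labelled by the vertices of $G$. A circuit (unitary) $U$ has range $R$ with respect to $G$ if for every vertex $v$ and every single-qubit observable $\mathcal O_v$ supported on $v$, $U^\dagger\mathcal O_vU$ is supported on the set $B_G(v,R)$ of vertices at distance at most $R$ from $v$. A state $|\phi\rangle$ on $n$ qubits is $\mathbf Z_2$-symmetric if $X^{\otimes n}|\phi\rangle=|\phi\rangle$; a unitary $U$ is $\mathbf Z_2$-symmetric if $X^{\otimes n}UX^{\otimes n}=U$. A state is prepared by a $\mathbf Z_2$-symmetric range-$R$ circuit if it equals $U|\phi\rangle$ with $U$ a $\mathbf Z_2$-symmetric range-$R$ circuit and $|\phi\rangle$ a $\mathbf Z_2$-symmetric product state. *)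

theory Defs
  imports "HOL-Analysis.Analysis" "HOL-Library.Extended_Nat"
begin

section \<open>Graphs\<close>

text \<open>The vertex set is the whole of a finite type; an edge is a two-element set of vertices.\<close>

definition simple_graph :: "'v set set \<Rightarrow> bool" where
  "simple_graph E \<longleftrightarrow> (\<forall>e\<in>E. card e = 2)"

definition adj :: "'v set set \<Rightarrow> 'v rel" where
  "adj E = {(u, v). {u, v} \<in> E}"

text \<open>Length of a shortest walk; \<open>\<infinity>\<close> between different connected components.\<close>

definition graph_dist :: "'v set set \<Rightarrow> 'v \<Rightarrow> 'v \<Rightarrow> enat" where
  "graph_dist E u v = (INF k\<in>{k. (u, v) \<in> adj E ^^ k}. enat k)"

definition graph_ball :: "'v set set \<Rightarrow> 'v \<Rightarrow> nat \<Rightarrow> 'v set" where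
  "graph_ball E v R = {w. graph_dist E v w \<le> enat R}"

text \<open>Cycles are subgraphs, given by their edge sets, so that neither the starting point
  nor the orientation matters when they are counted.\<close>

definition is_cycle :: "'v set set \<Rightarrow> nat \<Rightarrow> 'v set set \<Rightarrow> bool" where
  "is_cycle E k C \<longleftrightarrow> C \<subseteq> E \<and>
     (\<exists>p. length p = k \<and> k \<ge> 3 \<and> distinct p \<and> C = {{p ! i, p ! (Suc i mod k)} |i. i < k})"

definition num_cycles :: "'v set set \<Rightarrow> nat \<Rightarrow> nat" where
  "num_cycles E l = card {C. \<exists>k\<le>l. is_cycle E k C}"


section \<open>Qubits labelled by the vertices\<close>

text \<open>A computational basis state assigns a bit to each vertex, with \<open>False\<close> and \<open>True\<close> standing
  for 0 and 1.\<close>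

type_synonym 'v ket = "complex ^ ('v \<Rightarrow> bool)"
type_synonym 'v operator = "complex ^ ('v \<Rightarrow> bool) ^ ('v \<Rightarrow> bool)"

text \<open>The inner product that the library puts on complex vectors is real-valued, hence this one.
  The library norm is the Hilbert space norm.\<close>

definition braket :: "complex ^ 'n \<Rightarrow> complex ^ 'n \<Rightarrow> complex" where
  "braket \<phi> \<psi> = (\<Sum>x\<in>UNIV. cnj (\<phi> $ x) * \<psi> $ x)"

definition expect :: "complex ^ 'n \<Rightarrow> complex ^ 'n ^ 'n \<Rightarrow> complex" where
  "expect \<psi> A = braket \<psi> (A *v \<psi>)"

definition dagger :: "complex ^ 'n ^ 'm \<Rightarrow> complex ^ 'm ^ 'n" where
  "dagger A = (\<chi> i j. cnj (A $ j $ i))"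

definition hermitian :: "complex ^ 'n ^ 'n \<Rightarrow> bool" where
  "hermitian A \<longleftrightarrow> dagger A = A"

definition unitary :: "complex ^ 'n ^ 'n \<Rightarrow> bool" where
  "unitary U \<longleftrightarrow> dagger U ** U = mat 1 \<and> U ** dagger U = mat 1"

definition tensor_ket :: "('v::finite \<Rightarrow> complex ^ bool) \<Rightarrow> 'v ket" where
  "tensor_ket f = (\<chi> x. \<Prod>v\<in>UNIV. f v $ x v)"

definition tensor_op :: "('v::finite \<Rightarrow> complex ^ bool ^ bool) \<Rightarrow> 'v operator" where
  "tensor_op A = (\<chi> x y. \<Prod>v\<in>UNIV. A v $ x v $ y v)"

definition pauli_X :: "complex ^ bool ^ bool" where
  "pauli_X = (\<chi> a b. if a \<noteq> b then 1 else 0)"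

definition pauli_Z :: "complex ^ bool ^ bool" where
  "pauli_Z = (\<chi> a b. if a = b then (if a then -1 else 1) else 0)"

definition X_all :: "'v::finite operator" where
  "X_all = tensor_op (\<lambda>_. pauli_X)"

definition Z_at :: "'v::finite \<Rightarrow> 'v operator" where
  "Z_at v = tensor_op (\<lambda>w. if w = v then pauli_Z else mat 1)"

text \<open>The product over the two endpoints of an edge; their order does not matter,
  as \<open>ZZ_edge_eq\<close> below confirms.\<close>

definition ZZ_edge :: "'v::finite set \<Rightarrow> 'v operator" where
  "ZZ_edge e = (THE A. \<exists>u v. e = {u, v} \<and> A = Z_at u ** Z_at v)"

text \<open>\<open>A\<close> is \<open>B\<close> on the qubits in \<open>S\<close>, tensored with the identity on all others.\<close>

definition supported_on :: "'v::finite operator \<Rightarrow> 'v set \<Rightarrow> bool" where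
  "supported_on A S \<longleftrightarrow>
     (\<exists>B. \<forall>x y. A $ x $ y =
        (if \<forall>v. v \<notin> S \<longrightarrow> x v = y v then B (restrict x S) (restrict y S) else 0))"

definition has_range :: "'v::finite set set \<Rightarrow> nat \<Rightarrow> 'v operator \<Rightarrow> bool" where
  "has_range E R U \<longleftrightarrow>
     (\<forall>v A. hermitian A \<and> supported_on A {v} \<longrightarrow>
        supported_on (dagger U ** A ** U) (graph_ball E v R))"

definition product_state :: "'v::finite ket \<Rightarrow> bool" where
  "product_state \<phi> \<longleftrightarrow> (\<exists>f. (\<forall>v. norm (f v) = 1) \<and> \<phi> = tensor_ket f)"

definition Z2_symmetric_state :: "'v::finite ket \<Rightarrow> bool" where
  "Z2_symmetric_state \<phi> \<longleftrightarrow> X_all *v \<phi> = \<phi>"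

definition Z2_symmetric_op :: "'v::finite operator \<Rightarrow> bool" where
  "Z2_symmetric_op U \<longleftrightarrow> X_all ** U ** X_all = U"

definition prepared_by_Z2_symmetric :: "'v::finite set set \<Rightarrow> nat \<Rightarrow> 'v ket \<Rightarrow> bool" where
  "prepared_by_Z2_symmetric E R \<psi> \<longleftrightarrow>
     (\<exists>U \<phi>. unitary U \<and> has_range E R U \<and> Z2_symmetric_op U \<and>
        product_state \<phi> \<and> Z2_symmetric_state \<phi> \<and> \<psi> = U *v \<phi>)"

lemma tensor_op_mult: "tensor_op A ** tensor_op B = tensor_op (\<lambda>v. A v ** B v)"
proof -
  have "(\<Sum>z\<in>UNIV. (\<Prod>v\<in>UNIV. A v $ x v $ z v) * (\<Prod>v\<in>UNIV. B v $ z v $ y v))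
      = (\<Prod>v\<in>UNIV. \<Sum>c\<in>UNIV. A v $ x v $ c * B v $ c $ y v)" for x y :: "'a \<Rightarrow> bool"
    by (subst prod_sum_PiE) (auto simp: PiE_def Pi_def prod.distrib)
  then show ?thesis
    by (simp add: tensor_op_def matrix_matrix_mult_def vec_eq_iff)
qed

lemma Z_at_commute: "Z_at u ** Z_at v = Z_at v ** Z_at u"
  unfolding Z_at_def tensor_op_mult by (rule arg_cong[where f = tensor_op]) auto

lemma ZZ_edge_eq: "ZZ_edge {u, v} = Z_at u ** Z_at v"
  unfolding ZZ_edge_def
  by (rule the_equality) (auto simp: doubleton_eq_iff Z_at_commute)

end

theory Submission
  imports Defs
begin

text \<open>
  The energy is half of \<open>|E| + |F|\<close>, where \<open>F\<close> consists of the edges with expectation \<open>-1\<close>.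
  Call two vertices related if their bits are perfectly correlated or anticorrelated in \<open>\<psi>\<close>; this is
  an equivalence relation, and the endpoints of an edge of \<open>F\<close> are related. If \<open>u\<close> and \<open>v\<close> are at
  distance more than \<open>2R\<close>, their light cones are disjoint, so \<open>\<langle>Z_u Z_v\<rangle> = \<langle>Z_u\<rangle>\<langle>Z_v\<rangle> = 0\<close> by symmetry:
  related vertices are at distance at most \<open>2R\<close>. Choose a root in every class and direct
  each edge of \<open>F\<close> away from it. An edge that joins two vertices of equal depth, and any of two edges of
  \<open>F\<close> that point to the same vertex, lies on a cycle of length at most \<open>4R + 1\<close>. Hence at most \<open>n\<close> edges
  of \<open>F\<close> avoid all short cycles, and the others are covered by the short cycles.
\<close>

section \<open>Edges and short cycles\<close>

lemma adj_iff [simp]: "(u, v) \<in> adj E \<longleftrightarrow> {u, v} \<in> E"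
  by (simp add: adj_def)

lemma relpow_adj_sym:
  assumes "(u, v) \<in> adj E ^^ k"
  shows "(v, u) \<in> adj E ^^ k"
  using assms
proof (induction k arbitrary: v)
  case (Suc k)
  then obtain w where "(u, w) \<in> adj E ^^ k" "(w, v) \<in> adj E" by auto
  then have "(v, w) \<in> adj E" "(w, u) \<in> adj E ^^ k"
    using Suc.IH by (auto simp: insert_commute)
  then show ?case by (rule relpow_Suc_I2)
qed simp

text \<open>A shortest walk from \<open>a\<close> to \<open>b\<close> that avoids the edge repeats
  no vertex, so the edge closes it to a cycle.\<close>

lemma is_cycle_through_edge:
  assumes e: "{a, b} \<in> E" "a \<noteq> b" and walk: "(a, b) \<in> adj (E - {{a, b}}) ^^ m"
  shows "\<exists>k C. k \<le> Suc m \<and> is_cycle E k C \<and> {a, b} \<in> C"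
proof -
  let ?r = "adj (E - {{a, b}})"
  define l where "l = (LEAST l. (a, b) \<in> ?r ^^ l)"
  have l: "(a, b) \<in> ?r ^^ l" "l \<le> m"
    unfolding l_def using walk by (rule LeastI, rule Least_le)
  have least: "l \<le> j" if "(a, b) \<in> ?r ^^ j" for j
    unfolding l_def using that by (rule Least_le)
  obtain p where p: "p 0 = a" "p l = b" "\<And>i. i < l \<Longrightarrow> (p i, p (Suc i)) \<in> ?r"
    using l(1) unfolding relpow_fun_conv by auto
  \<comment> \<open>Lengths 0 and 1 are excluded by \<open>a \<noteq> b\<close> and by the removal
    of \<open>{a, b}\<close>, so the cycle has at least three vertices.\<close>
  have "l \<noteq> 0" using p(1,2) e(2) by metis
  moreover have "l \<noteq> 1" using p(1,2) p(3)[of 0] by auto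
  ultimately have l2: "l \<ge> 2" by simp
  have seg: "(p i, p (i + j)) \<in> ?r ^^ j" if "i + j \<le> l" for i j
    unfolding relpow_fun_conv by (rule exI[of _ "\<lambda>t. p (i + t)"]) (use that p(3) in auto)
  have neq: "p i \<noteq> p j" if "i < j" "j \<le> l" for i j
  proof
    assume eq: "p i = p j"
    have "(a, p i) \<in> ?r ^^ i" "(p i, b) \<in> ?r ^^ (l - j)"
      using seg[of 0 i] seg[of j "l - j"] that p eq by auto
    then have "l \<le> i + (l - j)" by (intro least relpow_trans)
    with that show False by simp
  qed
  have inj: "inj_on p {0..<Suc l}"
    by (rule linorder_inj_onI) (use neq in auto)
  let ?p = "map p [0..<Suc l]"
  let ?C = "{{?p ! i, ?p ! (Suc i mod Suc l)} |i. i < Suc l}"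
  have nth: "?p ! i = p i" if "i < Suc l" for i using that by (simp del: upt_Suc)
  \<comment> \<open>The wrap-around pair is the only one that does not come from the walk; it is the
    removed edge.\<close>
  have last: "{?p ! l, ?p ! (Suc l mod Suc l)} = {a, b}"
    using p(1,2) nth[of l] nth[of 0] by (simp add: insert_commute del: upt_Suc)
  have "{?p ! i, ?p ! (Suc i mod Suc l)} \<in> E" if "i < Suc l" for i
  proof (cases "i = l")
    case True
    with last e(1) show ?thesis by simp
  next
    case False
    with that have "i < l" by simp
    then show ?thesis using p(3)[of i] nth[of i] nth[of "Suc i"] by (simp del: upt_Suc)
  qed
  then have "?C \<subseteq> E" by blast
  moreover have "distinct ?p" using inj by (simp add: distinct_map del: upt_Suc)
  ultimately have "is_cycle E (Suc l) ?C"
    unfolding is_cycle_def using l2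
    by (intro conjI exI[of _ ?p]) (auto simp del: upt_Suc)
  moreover have "{a, b} \<in> ?C" using last by blast
  ultimately show ?thesis using l(2) by (intro exI[of _ "Suc l"] exI[of _ ?C]) simp
qed

section \<open>Depth and shortest walks from a root\<close>

definition depth :: "'v set set \<Rightarrow> 'v \<Rightarrow> 'v \<Rightarrow> nat" where
  "depth E r w = (LEAST k. (r, w) \<in> adj E ^^ k)"

text \<open>\<open>LEAST\<close> is unspecified where no walk exists, which is why a walk from the
  root is assumed here and below.\<close>

lemma depth_walk: "(r, w) \<in> adj E ^^ k \<Longrightarrow> (r, w) \<in> adj E ^^ depth E r w"
  unfolding depth_def by (rule LeastI)

lemma depth_le: "(r, w) \<in> adj E ^^ k \<Longrightarrow> depth E r w \<le> k"
  unfolding depth_def by (rule Least_le)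

lemma depth_predecessor:
  assumes "(r, w) \<in> adj E ^^ k" "depth E r w = Suc d"
  obtains u where "(r, u) \<in> adj E ^^ d" "depth E r u = d" "{u, w} \<in> E"
proof -
  from depth_walk[OF assms(1)] assms(2)
  obtain u where u: "(r, u) \<in> adj E ^^ d" "{u, w} \<in> E" by auto
  have "(r, w) \<in> adj E ^^ Suc (depth E r u)"
    using depth_walk[OF u(1)] u(2) by auto
  from depth_le[OF this] depth_le[OF u(1)] assms(2) have "depth E r u = d" by simp
  with u show thesis by (intro that)
qed

text \<open>Every step of a shortest walk from \<open>r\<close> increases the depth.\<close>

lemma shortest_walk_avoids_edge:
  assumes "(r, w) \<in> adj E ^^ k"
    and "depth E r a = depth E r b \<or> depth E r w < depth E r b"
  shows "(r, w) \<in> adj (E - {{a, b}}) ^^ depth E r w"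
  using assms
proof (induction "depth E r w" arbitrary: w k)
  case 0
  then have "(r, w) \<in> adj E ^^ 0" using depth_walk by metis
  then show ?case using 0 by simp
next
  case (Suc d)
  obtain u where u: "(r, u) \<in> adj E ^^ d" "depth E r u = d" "{u, w} \<in> E"
    using depth_predecessor Suc.prems(1) Suc.hyps(2) by metis
  have "(r, u) \<in> adj (E - {{a, b}}) ^^ depth E r u"
    using Suc.hyps u Suc.prems(2) by (intro Suc.hyps(1)) auto
  then have "(r, u) \<in> adj (E - {{a, b}}) ^^ d" by (simp only: u(2))
  \<comment> \<open>Under the first alternative \<open>a\<close> and \<open>b\<close> have equal
    depth, unlike \<open>u\<close> and \<open>w\<close>; under the second, \<open>b\<close> is
    deeper than both.\<close>
  moreover have "{u, w} \<noteq> {a, b}"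
    using Suc.hyps(2) Suc.prems(2) u(2) by (auto simp: doubleton_eq_iff)
  ultimately have "(r, w) \<in> adj (E - {{a, b}}) ^^ Suc d"
    using u(3) by (intro relpow_Suc_I) auto
  then show ?case using Suc.hyps(2) by simp
qed

text \<open>Shortest walks lead from \<open>a\<close> back to \<open>r\<close> and on to
  \<open>c\<close>, and one step more to \<open>b\<close>. With the closing edge the length is at
  most \<open>D + (D - 1) + 2\<close>. Allowing equal depths of \<open>a\<close> and
  \<open>b\<close> covers edges within a level as well as pairs of edges that meet at
  \<open>b\<close>.\<close>

lemma is_cycle_through_deep_edge:
  assumes "{a, b} \<in> E" "a \<noteq> b" "{c, b} \<in> E" "c \<noteq> a"
    and "(r, a) \<in> adj E ^^ i" "(r, c) \<in> adj E ^^ j"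
    and "depth E r a \<le> depth E r b" "depth E r c < depth E r b" "depth E r b \<le> D"
  shows "\<exists>k C. k \<le> 2 * D + 1 \<and> is_cycle E k C \<and> {a, b} \<in> C"
proof -
  let ?r = "adj (E - {{a, b}})"
  have "(r, a) \<in> ?r ^^ depth E r a"
    using assms(7) by (intro shortest_walk_avoids_edge[OF assms(5)]) linarith
  moreover have "(r, c) \<in> ?r ^^ depth E r c"
    using assms(8) by (intro shortest_walk_avoids_edge[OF assms(6)]) simp
  ultimately have "(a, c) \<in> ?r ^^ (depth E r a + depth E r c)"
    by (rule relpow_trans[OF relpow_adj_sym])
  moreover have "(c, b) \<in> ?r" using assms(3,4) by (auto simp: doubleton_eq_iff)
  ultimately have "(a, b) \<in> ?r ^^ Suc (depth E r a + depth E r c)"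
    by (rule relpow_Suc_I)
  from is_cycle_through_edge[OF assms(1,2) this] obtain k C where
    "k \<le> Suc (Suc (depth E r a + depth E r c))" "is_cycle E k C" "{a, b} \<in> C" by blast
  then show ?thesis using assms by (intro exI[of _ k] exI[of _ C]) linarith
qed

section \<open>Counting edges on and off short cycles\<close>

lemma card_cycle_le:
  assumes "is_cycle E k C"
  shows "card C \<le> k"
proof -
  from assms obtain p where C: "C = (\<lambda>i. {p ! i, p ! (Suc i mod k)}) ` {..<k}"
    unfolding is_cycle_def by blast
  show ?thesis unfolding C using card_image_le[of "{..<k}"] by simp
qed

lemma card_edges_on_short_cycles:
  fixes E :: "'v::finite set set"
  shows "card {e. \<exists>k C. k \<le> l \<and> is_cycle E k C \<and> e \<in> C} \<le> l * num_cycles E l"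
proof -
  let ?S = "{C. \<exists>k\<le>l. is_cycle E k C}"
  have "{e. \<exists>k C. k \<le> l \<and> is_cycle E k C \<and> e \<in> C} = \<Union>?S" by blast
  also have "card \<dots> \<le> (\<Sum>C\<in>?S. card C)" by (rule card_Union_le_sum_card)
  also have "\<dots> \<le> (\<Sum>C\<in>?S. l)" by (rule sum_mono) (auto dest: card_cycle_le)
  finally show ?thesis by (simp add: num_cycles_def mult.commute)
qed

text \<open>Edges off the short cycles are charged to their deeper endpoint, and no vertex is
  charged twice. Walks from the roots may use all of \<open>E\<close>; only edges of
  \<open>F\<close> must stay within one class of \<open>root\<close>.\<close>

lemma card_edges_near_roots_le:
  fixes E :: "'v::finite set set" and root :: "'v \<Rightarrow> 'v"
  assumes simple: "simple_graph E" and sub: "F \<subseteq> E"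
    and root: "\<And>a b. {a, b} \<in> F \<Longrightarrow> root a = root b"
    and near: "\<And>v. \<exists>k\<le>D. (root v, v) \<in> adj E ^^ k"
  shows "card F \<le> CARD('v) + (2 * D + 1) * num_cycles E (2 * D + 1)"
proof -
  define S where "S = {e. \<exists>k C. k \<le> 2 * D + 1 \<and> is_cycle E k C \<and> e \<in> C}"
  \<comment> \<open>Depth is measured from \<open>root b\<close>, which on \<open>F\<close> is also
    the root of the other endpoint.\<close>
  define head where "head e b \<longleftrightarrow>
    (\<exists>a. e = {a, b} \<and> depth E (root b) a < depth E (root b) b)" for e b
  have neq: "a \<noteq> b" if "{a, b} \<in> F" for a b
    using that sub simple unfolding simple_graph_def by fastforce
  have depth_D: "depth E (root v) v \<le> D" for v
    using near[of v] depth_le order_trans by metis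
  have reach: "\<exists>k. (root b, a) \<in> adj E ^^ k" if "{a, b} \<in> F" for a b
    using near[of a] root[OF that] by auto
  \<comment> \<open>If the depths were equal, the predecessor \<open>c\<close> of \<open>b\<close>
    on a shortest walk would be one level closer to the root, hence differ from \<open>a\<close>,
    and would yield a short cycle through the edge.\<close>
  have strict: "depth E (root b) a \<noteq> depth E (root b) b" if ab: "{a, b} \<in> F" "{a, b} \<notin> S" for a b
  proof
    assume eq: "depth E (root b) a = depth E (root b) b"
    obtain i j where walks: "(root b, a) \<in> adj E ^^ i" "(root b, b) \<in> adj E ^^ j"
      using reach[OF ab(1)] near[of b] by blast
    have "depth E (root b) b \<noteq> 0"
    proof
      assume "depth E (root b) b = 0"
      with eq walks have "(root b, a) \<in> adj E ^^ 0" "(root b, b) \<in> adj E ^^ 0"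
        using depth_walk by metis+
      with neq[OF ab(1)] show False by simp
    qed
    then obtain d where d: "depth E (root b) b = Suc d" by (cases "depth E (root b) b") auto
    obtain c where c: "(root b, c) \<in> adj E ^^ d" "depth E (root b) c = d" "{c, b} \<in> E"
      using depth_predecessor[OF walks(2) d] by blast
    have "c \<noteq> a" using c(2) d eq by auto
    then have "{a, b} \<in> S" unfolding S_def mem_Collect_eq
      using is_cycle_through_deep_edge[OF _ neq[OF ab(1)] c(3) _ walks(1) c(1)]
        sub ab(1) eq c(2) d depth_D[of b] by auto
    with ab show False by simp
  qed
  have "\<exists>b. head e b" if e: "e \<in> F - S" for e
  proof -
    obtain a b where ab: "e = {a, b}"
      using e sub simple unfolding simple_graph_def card_2_iff by blast
    with e have F: "{a, b} \<in> F" "{a, b} \<notin> S" by auto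
    from strict[OF this] consider "depth E (root b) a < depth E (root b) b"
      | "depth E (root a) b < depth E (root a) a"
      using root[OF F(1)] by (metis linorder_neqE_nat)
    then show ?thesis
      unfolding head_def ab using insert_commute[of a b "{}"] by cases blast+
  qed
  then obtain h where h: "\<And>e. e \<in> F - S \<Longrightarrow> head e (h e)" by metis
  \<comment> \<open>Two edges with the same head \<open>b\<close> have distinct tails closer to the
    root, whose walks from the root close a short cycle.\<close>
  have "inj_on h (F - S)"
  proof (rule inj_onI, rule ccontr)
    fix e e' assume e: "e \<in> F - S" "e' \<in> F - S" "h e = h e'" "e \<noteq> e'"
    define b where "b = h e"
    obtain a where a: "e = {a, b}" "depth E (root b) a < depth E (root b) b"
      using h[OF e(1)] unfolding head_def b_def by blast
    obtain c where c: "e' = {c, b}" "depth E (root b) c < depth E (root b) b"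
      using h[OF e(2)] e(3) unfolding head_def b_def by auto
    have F: "{a, b} \<in> F" "{c, b} \<in> F" "c \<noteq> a" using e a c by auto
    obtain i j where "(root b, a) \<in> adj E ^^ i" "(root b, c) \<in> adj E ^^ j"
      using reach F by blast
    then have "e \<in> S" unfolding S_def mem_Collect_eq a(1)
      using sub F neq a(2) c(2) depth_D[of b] by (intro is_cycle_through_deep_edge[of a b E c]) auto
    with e show False by simp
  qed
  then have "card (F - S) \<le> CARD('v)" by (rule card_inj_on_le) auto
  moreover have "card (F \<inter> S) \<le> card S" by (rule card_mono) auto
  moreover have "card F = card (F - S) + card (F \<inter> S)"
    using card_Int_Diff[of F S] by simp
  ultimately show ?thesis
    using card_edges_on_short_cycles[of "2 * D + 1" E] unfolding S_def by linarith
qed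

section \<open>Walks between vertices with overlapping balls\<close>

lemma graph_ball_walk:
  assumes "w \<in> graph_ball E v R"
  shows "\<exists>k\<le>R. (v, w) \<in> adj E ^^ k"
proof -
  \<comment> \<open>The infimum over no walks is \<open>\<infinity>\<close>, so a finite bound
    yields a walk; the strict form with \<open>Suc R\<close> fits
    \<open>INF_less_iff\<close>.\<close>
  have "(INF k\<in>{k. (v, w) \<in> adj E ^^ k}. enat k) < enat (Suc R)"
    using assms unfolding graph_ball_def graph_dist_def
    by (auto intro: le_less_trans)
  then show ?thesis unfolding INF_less_iff by (auto simp: less_Suc_eq_le)
qed

lemma graph_balls_meet_walk:
  assumes "graph_ball E u R \<inter> graph_ball E v R \<noteq> {}"
  shows "\<exists>k\<le>2 * R. (u, v) \<in> adj E ^^ k"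
proof -
  from assms obtain w i j where "i \<le> R" "(u, w) \<in> adj E ^^ i" "j \<le> R" "(v, w) \<in> adj E ^^ j"
    using graph_ball_walk by (metis disjoint_iff)
  then have "(u, v) \<in> adj E ^^ (i + j)" "i + j \<le> 2 * R"
    using relpow_trans[OF _ relpow_adj_sym] by auto
  then show ?thesis by blast
qed

section \<open>Expectation values\<close>

lemma braket_mult_left: "braket (A *v \<phi>) \<psi> = braket \<phi> (dagger A *v \<psi>)"
proof -
  have "braket (A *v \<phi>) \<psi> = (\<Sum>x\<in>UNIV. \<Sum>y\<in>UNIV. cnj (A $ x $ y) * cnj (\<phi> $ y) * \<psi> $ x)"
    by (simp add: braket_def matrix_vector_mult_def sum_distrib_right)
  also have "\<dots> = (\<Sum>y\<in>UNIV. \<Sum>x\<in>UNIV. cnj (A $ x $ y) * cnj (\<phi> $ y) * \<psi> $ x)"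
    by (rule sum.swap)
  also have "\<dots> = braket \<phi> (dagger A *v \<psi>)"
    by (simp add: braket_def dagger_def matrix_vector_mult_def sum_distrib_left mult_ac)
  finally show ?thesis .
qed

text \<open>The Heisenberg picture: the circuit moves from the state to the observable, where the
  range condition applies.\<close>

lemma expect_conj: "expect (U *v \<phi>) A = expect \<phi> (dagger U ** A ** U)"
  unfolding expect_def braket_mult_left by (simp add: matrix_vector_mul_assoc matrix_mul_assoc)

lemma expect_sum_entries: "expect \<psi> A = (\<Sum>x\<in>UNIV. \<Sum>y\<in>UNIV. cnj (\<psi> $ x) * A $ x $ y * \<psi> $ y)"
  by (simp add: expect_def braket_def matrix_vector_mult_def sum_distrib_left mult_ac)

lemma expect_add: "expect \<psi> (A + B) = expect \<psi> A + expect \<psi> B"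
  by (simp add: expect_sum_entries algebra_simps sum.distrib)

lemma expect_diff: "expect \<psi> (A - B) = expect \<psi> A - expect \<psi> B"
  by (simp add: expect_sum_entries algebra_simps sum_subtractf)

lemma expect_scaleR: "expect \<psi> (c *\<^sub>R A) = c *\<^sub>R expect \<psi> A"
  by (simp add: expect_sum_entries scaleR_sum_right)

lemma expect_sum: "expect \<psi> (\<Sum>i\<in>I. A i) = (\<Sum>i\<in>I. expect \<psi> (A i))"
  by (induction I rule: infinite_finite_induct)
    (simp_all add: expect_add expect_sum_entries[of _ 0])

lemma expect_tensor_ket_mat_1:
  assumes "\<And>v. norm (f v) = 1"
  shows "expect (tensor_ket f) (mat 1) = 1"
proof -
  have f: "(\<Sum>c\<in>UNIV. cnj (f v $ c) * f v $ c) = 1" for v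
  proof -
    have "(\<Sum>c\<in>UNIV. cnj (f v $ c) * f v $ c) = of_real (\<Sum>c\<in>UNIV. (norm (f v $ c))\<^sup>2)"
      by (simp only: of_real_sum complex_norm_square mult.commute)
    also have "(\<Sum>c\<in>UNIV. (norm (f v $ c))\<^sup>2) = (norm (f v))\<^sup>2"
      by (simp add: norm_vec_def L2_set_def sum_nonneg)
    finally show ?thesis using assms by simp
  qed
  have "(\<Sum>x\<in>UNIV. \<Prod>v\<in>UNIV. cnj (f v $ x v) * f v $ x v) = (\<Prod>v\<in>UNIV. \<Sum>c\<in>UNIV. cnj (f v $ c) * f v $ c)"
    by (subst prod_sum_PiE) (auto simp: PiE_def Pi_def)
  then show ?thesis
    by (simp add: expect_def braket_def tensor_ket_def prod.distrib f)
qed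

section \<open>Factorization over disjoint supports\<close>

lemma supported_on_mult_entry:
  fixes S T :: "'v::finite set"
  assumes A: "\<And>x y. A $ x $ y =
        (if \<forall>v. v \<notin> S \<longrightarrow> x v = y v then a (restrict x S) (restrict y S) else 0)"
    and B: "\<And>x y. B $ x $ y =
        (if \<forall>v. v \<notin> T \<longrightarrow> x v = y v then b (restrict x T) (restrict y T) else 0)"
    and ST: "S \<inter> T = {}"
  shows "(A ** B) $ x $ z = (if \<forall>v. v \<notin> S \<union> T \<longrightarrow> x v = z v
    then a (restrict x S) (restrict z S) * b (restrict x T) (restrict z T) else 0)"
proof -
  \<comment> \<open>\<open>A\<close> changes only bits in \<open>S\<close> and \<open>B\<close> only
    bits in \<open>T\<close>, so a single intermediate basis state can contribute.\<close>
  define y where "y = (\<lambda>v. if v \<in> S then z v else x v)"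
  have "A $ x $ w * B $ w $ z = 0" if "w \<noteq> y" for w
  proof (rule ccontr)
    assume "A $ x $ w * B $ w $ z \<noteq> 0"
    then have "\<forall>v. v \<notin> S \<longrightarrow> x v = w v" "\<forall>v. v \<notin> T \<longrightarrow> w v = z v"
      unfolding A B by (auto split: if_splits)
    then have "w = y" using ST by (auto simp: y_def fun_eq_iff)
    with that show False by simp
  qed
  then have "(A ** B) $ x $ z = (\<Sum>w\<in>{y}. A $ x $ w * B $ w $ z)"
    unfolding matrix_matrix_mult_def vec_lambda_beta by (intro sum.mono_neutral_right) auto
  then have "(A ** B) $ x $ z = A $ x $ y * B $ y $ z" by simp
  moreover have r: "restrict y S = restrict z S" "restrict y T = restrict x T"
    using ST by (auto simp: y_def restrict_def fun_eq_iff)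
  have "A $ x $ y = a (restrict x S) (restrict z S)"
    by (simp add: A r) (simp add: y_def)
  moreover have "(\<forall>v. v \<notin> T \<longrightarrow> y v = z v) \<longleftrightarrow> (\<forall>v. v \<notin> S \<union> T \<longrightarrow> x v = z v)"
    by (auto simp: y_def)
  then have "B $ y $ z = (if \<forall>v. v \<notin> S \<union> T \<longrightarrow> x v = z v
    then b (restrict x T) (restrict z T) else 0)"
    by (simp only: B r)
  ultimately show ?thesis by (simp only: if_distrib[of "(*) _"] mult_zero_right)
qed

text \<open>Take two copies of the system. Exchanging the qubits in \<open>T\<close> between the copies fixes the
  product state \<open>\<phi> \<otimes> \<phi>\<close> and turns \<open>A \<otimes> B\<close> into \<open>AB \<otimes> 1\<close>.\<close>

lemma expect_mult_disjoint_support: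
  fixes A B :: "'v::finite operator"
  assumes \<phi>: "\<phi> = tensor_ket f" and norm: "expect \<phi> (mat 1) = 1"
    and suppA: "supported_on A S" and suppB: "supported_on B T" and ST: "S \<inter> T = {}"
  shows "expect \<phi> (A ** B) = expect \<phi> A * expect \<phi> B"
proof -
  obtain a where A: "\<And>x y. A $ x $ y =
        (if \<forall>v. v \<notin> S \<longrightarrow> x v = y v then a (restrict x S) (restrict y S) else 0)"
    using suppA unfolding supported_on_def by blast
  obtain b where B: "\<And>x y. B $ x $ y =
        (if \<forall>v. v \<notin> T \<longrightarrow> x v = y v then b (restrict x T) (restrict y T) else 0)"
    using suppB unfolding supported_on_def by blast
  define m where "m x y = (\<lambda>v. if v \<in> T then y v else x v)" for x y :: "'v \<Rightarrow> bool"
  have mm: "m (m x y) (m y x) = x" for x y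
    by (simp add: m_def fun_eq_iff)
  have ket: "\<phi> $ m x y * \<phi> $ m y x = \<phi> $ x * \<phi> $ y" for x y
    unfolding \<phi> tensor_ket_def m_def
    by (simp flip: prod.distrib) (rule prod.cong, auto)
  have cnj_ket: "cnj (\<phi> $ m x y) * cnj (\<phi> $ m y x) = cnj (\<phi> $ x) * cnj (\<phi> $ y)" for x y
    using arg_cong[OF ket[of x y], of cnj] by simp
  \<comment> \<open>After the exchange, the bits that \<open>A\<close> and \<open>B\<close> act on
    all come from \<open>x\<close> and \<open>x'\<close>; nothing acts on the second copy.\<close>
  have op: "A $ m x y $ m x' y' * B $ m y x $ m y' x' = (A ** B) $ x $ x' * mat 1 $ y $ y'"
    for x y x' y'
  proof -
    have r: "restrict (m x y) S = restrict x S" "restrict (m x y) T = restrict y T" for x y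
      using ST by (auto simp: m_def restrict_def fun_eq_iff)
    define cA where "cA \<longleftrightarrow> (\<forall>v. v \<notin> S \<longrightarrow> m x y v = m x' y' v)"
    define cB where "cB \<longleftrightarrow> (\<forall>v. v \<notin> T \<longrightarrow> m y x v = m y' x' v)"
    define cAB where "cAB \<longleftrightarrow> (\<forall>v. v \<notin> S \<union> T \<longrightarrow> x v = x' v)"
    define \<alpha> where "\<alpha> = a (restrict x S) (restrict x' S)"
    define \<beta> where "\<beta> = b (restrict x T) (restrict x' T)"
    have "A $ m x y $ m x' y' = (if cA then \<alpha> else 0)" "B $ m y x $ m y' x' = (if cB then \<beta> else 0)"
      unfolding A B r cA_def cB_def \<alpha>_def \<beta>_def by (rule refl)+
    moreover have "(A ** B) $ x $ x' = (if cAB then \<alpha> * \<beta> else 0)"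
      unfolding supported_on_mult_entry[OF A B ST] cAB_def \<alpha>_def \<beta>_def by (rule refl)
    moreover have "mat 1 $ y $ y' = (if y = y' then 1 else (0 :: complex))"
      by (simp add: mat_def)
    \<comment> \<open>The comparison in \<open>cA\<close> covers \<open>y\<close> on
      \<open>T\<close> and \<open>x\<close> outside both supports; the one in \<open>cB\<close>
      covers \<open>y\<close> off \<open>T\<close>.\<close>
    moreover have "cA \<and> cB \<longleftrightarrow> cAB \<and> y = y'"
      using ST unfolding cA_def cB_def cAB_def m_def fun_eq_iff by auto
    ultimately show ?thesis by auto
  qed
  define g where "g P Q = (\<lambda>((x, x'), (y, y')). cnj (\<phi> $ x) * cnj (\<phi> $ y)
    * (P $ x $ x' * Q $ y $ y') * (\<phi> $ x' * \<phi> $ y'))" for P Q :: "'v operator"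
  define swap where "swap = (\<lambda>((x, x'), (y, y')). ((m x y, m x' y'), (m y x, m y' x')))"
  have prod: "expect \<phi> P * expect \<phi> Q = sum (g P Q) UNIV" for P Q
  proof -
    have pairs: "expect \<phi> P = (\<Sum>(x, x')\<in>UNIV. cnj (\<phi> $ x) * P $ x $ x' * \<phi> $ x')" for P
      unfolding expect_sum_entries by (simp add: sum.cartesian_product)
    show ?thesis
      unfolding pairs sum_product
      by (simp add: sum.cartesian_product g_def case_prod_unfold mult_ac)
  qed
  have "g A B (swap p) = g (A ** B) (mat 1) p" for p
  proof -
    obtain x x' y y' where p: "p = ((x, x'), (y, y'))" by (metis surj_pair)
    show ?thesis unfolding p g_def swap_def prod.case op ket cnj_ket ..
  qed
  moreover have "swap (swap p) = p" for p
    by (simp add: swap_def mm split: prod.splits)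
  \<comment> \<open>The exchange is an involution on the indices, hence permutes the terms.\<close>
  ultimately have "sum (g A B) UNIV = sum (g (A ** B) (mat 1)) UNIV"
    by (intro sum.reindex_bij_witness[of _ swap swap]) (simp_all only: UNIV_I, metis)
  then have "expect \<phi> A * expect \<phi> B = expect \<phi> (A ** B) * expect \<phi> (mat 1)"
    by (simp only: prod)
  then show ?thesis using norm by simp
qed

section \<open>Pauli operators in the computational basis and the global flip\<close>

definition spin :: "bool \<Rightarrow> complex" where
  "spin b = (if b then -1 else 1)"

lemma Z_at_entry: "Z_at u $ x $ y = (if x = y then spin (x u) else 0)"
proof (cases "x = y")
  case True
  have "(\<Prod>v\<in>UNIV. (if v = u then pauli_Z else mat 1) $ x v $ x v) = (\<Prod>v\<in>UNIV. if v = u then spin (x v) else 1)"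
    by (rule prod.cong) (auto simp: pauli_Z_def mat_def spin_def)
  with True show ?thesis by (simp add: Z_at_def tensor_op_def)
next
  case False
  then obtain v where "x v \<noteq> y v" by auto
  then have "(if v = u then pauli_Z else mat 1) $ x v $ y v = 0"
    by (auto simp: pauli_Z_def mat_def)
  then have "(\<Prod>v\<in>UNIV. (if v = u then pauli_Z else mat 1) $ x v $ y v) = 0"
    by (intro prod_zero bexI[of _ v]) auto
  with False show ?thesis by (simp add: Z_at_def tensor_op_def)
qed

lemma ZZ_entry: "(Z_at u ** Z_at v) $ x $ y = (if x = y then spin (x u) * spin (x v) else 0)"
  by (simp add: matrix_matrix_mult_def Z_at_entry if_distrib[of "\<lambda>t. _ * t"] if_distrib[of "\<lambda>t. t * _"]
      sum.delta cong: if_cong)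

lemma expect_diagonal:
  assumes "\<And>x y. A $ x $ y = (if x = y then d x else 0)"
  shows "expect \<psi> A = (\<Sum>x\<in>UNIV. d x * of_real ((norm (\<psi> $ x))\<^sup>2))"
proof -
  have "expect \<psi> A = (\<Sum>x\<in>UNIV. \<Sum>y\<in>UNIV. if x = y then cnj (\<psi> $ x) * d x * \<psi> $ x else 0)"
    unfolding expect_sum_entries assms by (intro sum.cong) auto
  also have "\<dots> = (\<Sum>x\<in>UNIV. d x * of_real ((norm (\<psi> $ x))\<^sup>2))"
    by (simp only: complex_norm_square sum.delta') (simp add: mult_ac)
  finally show ?thesis .
qed

lemma X_all_mult_entry: "(X_all *v \<psi>) $ x = \<psi> $ (\<lambda>v. \<not> x v)"
proof -
  have "X_all $ x $ y = (if y = (\<lambda>v. \<not> x v) then 1 else 0)" for y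
  proof (cases "y = (\<lambda>v. \<not> x v)")
    case False
    then obtain v where "y v = x v" by auto
    then have "(\<Prod>v\<in>UNIV. pauli_X $ x v $ y v) = 0"
      by (intro prod_zero bexI[of _ v]) (auto simp: pauli_X_def)
    with False show ?thesis by (simp add: X_all_def tensor_op_def)
  qed (simp add: X_all_def tensor_op_def pauli_X_def)
  then show ?thesis
    by (simp add: matrix_vector_mult_def if_distrib[of "\<lambda>t. t * _"] cong: if_cong)
qed

text \<open>The global flip keeps all weights and reverses every spin, so the expectation equals its
  own negative.\<close>

lemma expect_Z_at_symmetric:
  assumes "Z2_symmetric_state \<psi>"
  shows "expect \<psi> (Z_at u) = 0"
proof -
  have flip: "\<psi> $ (\<lambda>v. \<not> x v) = \<psi> $ x" for x
    using assms X_all_mult_entry[of \<psi> x] unfolding Z2_symmetric_state_def by simp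
  have "expect \<psi> (Z_at u) = (\<Sum>x\<in>UNIV. spin (x u) * of_real ((norm (\<psi> $ x))\<^sup>2))"
    by (rule expect_diagonal) (rule Z_at_entry)
  also have "\<dots> = (\<Sum>x\<in>UNIV. - (spin (x u) * of_real ((norm (\<psi> $ x))\<^sup>2)))"
    by (rule sum.reindex_bij_witness[of _ "\<lambda>x v. \<not> x v" "\<lambda>x v. \<not> x v"])
      (auto simp: flip spin_def)
  finally have "expect \<psi> (Z_at u) = - expect \<psi> (Z_at u)"
    by (simp add: sum_negf expect_diagonal[OF Z_at_entry])
  then show ?thesis by simp
qed

lemma Z2_symmetric_op_apply:
  assumes "Z2_symmetric_op U" "Z2_symmetric_state \<phi>"
  shows "Z2_symmetric_state (U *v \<phi>)"
proof -
  have XX: "X_all *v (X_all *v \<eta>) = \<eta>" for \<eta> :: "'a ket"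
    by (simp add: vec_eq_iff X_all_mult_entry)
  have "U *v \<phi> = X_all *v (U *v (X_all *v \<phi>))"
    using assms(1) unfolding Z2_symmetric_op_def by (simp add: matrix_vector_mul_assoc matrix_mul_assoc)
  also have "\<dots> = X_all *v (U *v \<phi>)"
    using assms(2) unfolding Z2_symmetric_state_def by simp
  finally show ?thesis unfolding Z2_symmetric_state_def by simp
qed

lemma hermitian_Z_at: "hermitian (Z_at u)"
  by (auto simp: hermitian_def dagger_def vec_eq_iff Z_at_entry spin_def)

lemma supported_on_Z_at: "supported_on (Z_at u) {u}"
  unfolding supported_on_def Z_at_entry
  by (rule exI[of _ "\<lambda>x y. if x u = y u then spin (x u) else 0"]) (auto simp: fun_eq_iff)

section \<open>States prepared by symmetric circuits\<close>

lemma prepared_expect_mat_1: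
  assumes "prepared_by_Z2_symmetric E R \<psi>"
  shows "expect \<psi> (mat 1) = 1"
proof -
  obtain U f where "unitary U" "\<psi> = U *v tensor_ket f" "\<And>v. norm (f v) = 1"
    using assms unfolding prepared_by_Z2_symmetric_def product_state_def by blast
  then show ?thesis
    using expect_tensor_ket_mat_1[of f] by (simp add: expect_conj unitary_def)
qed

text \<open>Disjoint light cones make the expectation factor, and symmetry annihilates the first
  factor.\<close>

lemma prepared_expect_ZZ_far:
  assumes "prepared_by_Z2_symmetric E R \<psi>"
    and disj: "graph_ball E u R \<inter> graph_ball E v R = {}"
  shows "expect \<psi> (Z_at u ** Z_at v) = 0"
proof -
  obtain U \<phi> f where U: "unitary U" "has_range E R U" "Z2_symmetric_op U"
    and \<phi>: "\<And>v. norm (f v) = 1" "\<phi> = tensor_ket f" "Z2_symmetric_state \<phi>" and \<psi>: "\<psi> = U *v \<phi>"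
    using assms(1) unfolding prepared_by_Z2_symmetric_def product_state_def by blast
  let ?H = "\<lambda>w. dagger U ** Z_at w ** U"
  have supp: "supported_on (?H w) (graph_ball E w R)" for w
    using U(2) hermitian_Z_at supported_on_Z_at unfolding has_range_def by blast
  \<comment> \<open>A cancelling \<open>U ** dagger U\<close> between the factors lets each
    \<open>Z_at\<close> evolve separately.\<close>
  have "?H u ** ?H v = dagger U ** Z_at u ** (U ** dagger U) ** Z_at v ** U"
    by (simp only: matrix_mul_assoc)
  also have "\<dots> = dagger U ** (Z_at u ** Z_at v) ** U"
    using U(1) by (simp add: unitary_def matrix_mul_assoc)
  finally have "expect \<psi> (Z_at u ** Z_at v) = expect \<phi> (?H u ** ?H v)"
    by (simp add: \<psi> expect_conj)
  also have "\<dots> = expect \<phi> (?H u) * expect \<phi> (?H v)"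
    using expect_tensor_ket_mat_1[OF \<phi>(1)] \<phi>(2) supp disj by (intro expect_mult_disjoint_support) auto
  also have "expect \<phi> (?H u) = expect \<psi> (Z_at u)" by (simp add: \<psi> expect_conj)
  also have "\<dots> = 0"
    unfolding \<psi> by (intro expect_Z_at_symmetric Z2_symmetric_op_apply U \<phi>)
  finally show ?thesis by simp
qed

section \<open>Perfectly correlated vertices\<close>

text \<open>Correlation is read off the support of \<open>\<psi>\<close> in the computational basis.
  Both signs are allowed because two anticorrelations compose to a correlation; this makes the
  relation transitive.\<close>

definition correlated :: "'v::finite ket \<Rightarrow> 'v \<Rightarrow> 'v \<Rightarrow> bool" where
  "correlated \<psi> u v \<longleftrightarrow> (\<exists>c. \<forall>x. \<psi> $ x \<noteq> 0 \<longrightarrow> (x u = x v) = c)"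

lemma correlated_refl: "correlated \<psi> u u"
  by (auto simp: correlated_def)

lemma correlated_sym: "correlated \<psi> u v \<Longrightarrow> correlated \<psi> v u"
  unfolding correlated_def by metis

lemma correlated_trans: "correlated \<psi> u v \<Longrightarrow> correlated \<psi> v w \<Longrightarrow> correlated \<psi> u w"
  unfolding correlated_def by metis

lemma expect_ZZ:
  "expect \<psi> (Z_at u ** Z_at v) = (\<Sum>x\<in>UNIV. spin (x u) * spin (x v) * of_real ((norm (\<psi> $ x))\<^sup>2))"
  by (rule expect_diagonal) (rule ZZ_entry)

lemma expect_mat_1: "expect \<psi> (mat 1) = (\<Sum>x\<in>UNIV. of_real ((norm (\<psi> $ x))\<^sup>2))"
  using expect_diagonal[of "mat 1" "\<lambda>_. 1" \<psi>] by (simp add: mat_def)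

text \<open>Adding the squared norm to the expectation leaves twice the weight of the basis states
  with equal bits at \<open>u\<close> and \<open>v\<close>. This is 0, so only unequal bits
  occur.\<close>

lemma correlated_of_expect:
  assumes "expect \<psi> (mat 1) = 1" "expect \<psi> (Z_at u ** Z_at v) = - 1"
  shows "correlated \<psi> u v"
proof -
  have "of_real (\<Sum>x\<in>UNIV. if x u = x v then 2 * (norm (\<psi> $ x))\<^sup>2 else 0)
      = expect \<psi> (mat 1) + expect \<psi> (Z_at u ** Z_at v)"
    unfolding expect_ZZ expect_mat_1 sum.distrib[symmetric] of_real_sum
    by (intro sum.cong) (auto simp: spin_def)
  then have "(\<Sum>x\<in>UNIV. if x u = x v then 2 * (norm (\<psi> $ x))\<^sup>2 else 0) = 0"
    using assms by (simp del: of_real_sum)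
  then have "\<forall>x. (if x u = x v then 2 * (norm (\<psi> $ x))\<^sup>2 else 0) = 0"
    by (subst (asm) sum_nonneg_eq_0_iff) auto
  then show ?thesis unfolding correlated_def
    by (intro exI[of _ False]) (auto split: if_splits)
qed

text \<open>The product of the two spins is constant on the support, so the expectation is 1 or
  -1.\<close>

lemma expect_of_correlated:
  assumes "expect \<psi> (mat 1) = 1" "correlated \<psi> u v"
  shows "expect \<psi> (Z_at u ** Z_at v) \<noteq> 0"
proof -
  obtain c where c: "\<And>x. \<psi> $ x \<noteq> 0 \<Longrightarrow> (x u = x v) = c"
    using assms(2) unfolding correlated_def by blast
  have "expect \<psi> (Z_at u ** Z_at v) = (if c then 1 else - 1) * expect \<psi> (mat 1)"
    unfolding expect_ZZ expect_mat_1 sum_distrib_left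
  proof (rule sum.cong)
    fix x show "spin (x u) * spin (x v) * of_real ((norm (\<psi> $ x))\<^sup>2)
        = (if c then 1 else - 1) * of_real ((norm (\<psi> $ x))\<^sup>2)"
      using c[of x] by (cases "\<psi> $ x = 0") (auto simp: spin_def)
  qed simp
  with assms(1) show ?thesis by simp
qed

text \<open>Disjoint balls would force a zero expectation, which perfect correlation forbids. This
  places every vertex near the root of its class.\<close>

lemma correlated_walk:
  assumes "prepared_by_Z2_symmetric E R \<psi>" "correlated \<psi> u v"
  shows "\<exists>k\<le>2 * R. (u, v) \<in> adj E ^^ k"
  using graph_balls_meet_walk[of E u R v] prepared_expect_ZZ_far[OF assms(1), of u v]
    expect_of_correlated[OF prepared_expect_mat_1[OF assms(1)] assms(2)] by blast

theorem proposition41: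
  fixes E :: "'v::finite set set" and R :: nat and \<psi> :: "'v ket"
  assumes "simple_graph E"
    and "prepared_by_Z2_symmetric E R \<psi>"
    and "\<And>u v. {u, v} \<in> E \<Longrightarrow> expect \<psi> (Z_at u ** Z_at v) \<in> {0, -1}"
  shows "Re (expect \<psi> (\<Sum>e\<in>E. (1 / 2) *\<^sub>R (mat 1 - ZZ_edge e)))
    \<le> 1 / 2 * (real (card E) + real CARD('v) + (4 * real R + 1) * real (num_cycles E (4 * R + 1)))"
proof -
  define F where "F = {e \<in> E. expect \<psi> (ZZ_edge e) = -1}"
  define root where "root v = (SOME u. correlated \<psi> u v)" for v
  have root: "correlated \<psi> (root v) v" for v
    unfolding root_def by (rule someI) (rule correlated_refl)
  have "root a = root b" if "{a, b} \<in> F" for a b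
  proof -
    have "correlated \<psi> a b"
      using that correlated_of_expect[OF prepared_expect_mat_1[OF assms(2)]]
      by (simp add: F_def ZZ_edge_eq)
    \<comment> \<open>Related vertices define the same predicate, hence get the same
      \<open>SOME\<close> choice as root.\<close>
    then have "correlated \<psi> u a \<longleftrightarrow> correlated \<psi> u b" for u
      using correlated_trans correlated_sym by blast
    then show ?thesis by (simp add: root_def)
  qed
  \<comment> \<open>The depth bound is \<open>D = 2 * R\<close>, so \<open>2 * D + 1\<close> becomes
    \<open>4 * R + 1\<close>.\<close>
  then have "card F \<le> CARD('v) + (2 * (2 * R) + 1) * num_cycles E (2 * (2 * R) + 1)"
    using correlated_walk[OF assms(2) root]
    by (intro card_edges_near_roots_le[OF assms(1), of F root]) (auto simp: F_def)
  then have "real (card F) \<le> real (CARD('v) + (4 * R + 1) * num_cycles E (4 * R + 1))"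
    by (simp only: of_nat_le_iff) simp
  then have F: "real (card F) \<le> real CARD('v) + (4 * real R + 1) * real (num_cycles E (4 * R + 1))"
    by (simp only: of_nat_add of_nat_mult of_nat_numeral of_nat_1)
  \<comment> \<open>An edge of \<open>F\<close> contributes energy 1, any other edge 1/2.\<close>
  have edge: "Re (expect \<psi> ((1 / 2) *\<^sub>R (mat 1 - ZZ_edge e))) = 1 / 2 * (1 + (if e \<in> F then 1 else 0))"
    if "e \<in> E" for e
  proof -
    have "card e = 2" using that assms(1) by (simp add: simple_graph_def)
    then obtain a b where ab: "e = {a, b}" by (auto simp: card_2_iff)
    then have "expect \<psi> (ZZ_edge e) \<in> {0, -1}"
      using assms(3)[of a b] that by (simp add: ZZ_edge_eq)
    then have "Re (expect \<psi> (ZZ_edge e)) = - (if e \<in> F then 1 else 0)"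
      using that by (auto simp: F_def)
    then show ?thesis
      by (simp add: expect_scaleR expect_diff prepared_expect_mat_1[OF assms(2)])
  qed
  have "Re (expect \<psi> (\<Sum>e\<in>E. (1 / 2) *\<^sub>R (mat 1 - ZZ_edge e)))
      = 1 / 2 * (\<Sum>e\<in>E. 1 + (if e \<in> F then 1 else 0))"
    unfolding expect_sum Re_sum sum_distrib_left by (intro sum.cong) (simp_all only: edge)
  also have "(\<Sum>e\<in>E. 1 + (if e \<in> F then 1 else 0 :: real)) = real (card E) + real (card F)"
    by (simp add: sum.distrib F_def flip: sum.inter_filter)
  finally show ?thesis using F by simp
qed

end
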